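(* If $G$ is a triangle-free $d$-regular graph with $n\geq 4$ vertices, then $\mathsf{wd}(G)>d-\sqrt{n}-1$. In particular, the complete bipartite graph $K_{d,d}$ with $d\geq 2$ satisfies $\mathsf{wd}(K_{d,d})>d-\sqrt{2d}-1$.
   Context: All graphs are finite and simple; $\mathbb{N}=\{0,1,2,\ldots\}$. Weak degeneracy: let $G$ be a graph and $f\colon V(G)\to\mathbb{N}$. For a vertex $u$, the operation $\mathrm{Delete}(G,f,u)$ outputs $G'=G-u$ and $f'\colon V(G')\to\mathbb{Z}$ with $f'(v)=f(v)-1$ if $uv\in E(G)$ and $f'(v)=f(v)$ otherwise; its application is legal if $f'(v)\geq 0$ for all $v\in V(G')$. For adjacent vertices $u,w$, the operation $\mathrm{DelSave}(G,f,u,w)$ outputs $G'=G-u$ and $f'\colon V(G')\to\mathbb{Z}$ with $f'(v)=f(v)-1$ if $uv\in E(G)$ and $v\neq w$, and $f'(v)=f(v)$ otherwise; its application is legal if $f(u)>f(w)$ and $f'$ is non-negative. $G$ is weakly $f$-degenerate if all vertices of $G$ can be removed by a sequence of legal applications of Delete and DelSave, starting with $(G,f)$. For $d\in\mathbb{N}$, $G$ is weakly $d$-degenerate if it is weakly degenerate with respect to the constant $d$ function. The weak degeneracy $\mathsf{wd}(G)$ is the minimum $d$ such that $G$ is weakly $d$-degenerate. *)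

theory Defs
  imports Complex_Main "Graph_Theory.Graph_Theory"
begin

text \<open>
  Finite simple graphs are the members of the locale \<^locale>\<open>graph\<close>: finite symmetric digraphs
  without loops and parallel arcs. An edge \<open>uv\<close> is a pair of opposite arcs, so the degree of a
  vertex is its \<^const>\<open>out_degree\<close>.
\<close>

definition regular_graph :: "nat \<Rightarrow> ('a, 'b) pre_digraph \<Rightarrow> bool" where
  "regular_graph d G \<longleftrightarrow> (\<forall>v \<in> verts G. out_degree G v = d)"

definition triangle_free :: "('a, 'b) pre_digraph \<Rightarrow> bool" where
  "triangle_free G \<longleftrightarrow>
    \<not> (\<exists>u v w. u \<rightarrow>\<^bsub>G\<^esub> v \<and> v \<rightarrow>\<^bsub>G\<^esub> w \<and> w \<rightarrow>\<^bsub>G\<^esub> u)"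

text \<open>
  The functions \<open>f\<close> are total and integer-valued, since the operations may output negative values
  before legality is checked; values outside the vertex set are never inspected.
\<close>

definition Delete ::
    "('a, 'b) pre_digraph \<Rightarrow> ('a \<Rightarrow> int) \<Rightarrow> 'a \<Rightarrow> ('a, 'b) pre_digraph \<times> ('a \<Rightarrow> int)" where
  "Delete G f u =
    (pre_digraph.del_vert G u, \<lambda>v. if u \<rightarrow>\<^bsub>G\<^esub> v then f v - 1 else f v)"

definition DelSave ::
    "('a, 'b) pre_digraph \<Rightarrow> ('a \<Rightarrow> int) \<Rightarrow> 'a \<Rightarrow> 'a
      \<Rightarrow> ('a, 'b) pre_digraph \<times> ('a \<Rightarrow> int)" where
  "DelSave G f u w =
    (pre_digraph.del_vert G u, \<lambda>v. if u \<rightarrow>\<^bsub>G\<^esub> v \<and> v \<noteq> w then f v - 1 else f v)"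

definition nonneg_on_verts :: "('a, 'b) pre_digraph \<times> ('a \<Rightarrow> int) \<Rightarrow> bool" where
  "nonneg_on_verts = (\<lambda>(G, f). \<forall>v \<in> verts G. f v \<ge> 0)"

definition legal_Delete :: "('a, 'b) pre_digraph \<Rightarrow> ('a \<Rightarrow> int) \<Rightarrow> 'a \<Rightarrow> bool" where
  "legal_Delete G f u \<longleftrightarrow> u \<in> verts G \<and> nonneg_on_verts (Delete G f u)"

definition legal_DelSave :: "('a, 'b) pre_digraph \<Rightarrow> ('a \<Rightarrow> int) \<Rightarrow> 'a \<Rightarrow> 'a \<Rightarrow> bool" where
  "legal_DelSave G f u w \<longleftrightarrow>
    u \<in> verts G \<and> w \<in> verts G \<and> u \<rightarrow>\<^bsub>G\<^esub> w \<and> f u > f w \<and> nonneg_on_verts (DelSave G f u w)"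

inductive removable :: "('a, 'b) pre_digraph \<times> ('a \<Rightarrow> int) \<Rightarrow> bool" where
  empty: "verts G = {} \<Longrightarrow> removable (G, f)"
| Delete: "legal_Delete G f u \<Longrightarrow> removable (Delete G f u) \<Longrightarrow> removable (G, f)"
| DelSave: "legal_DelSave G f u w \<Longrightarrow> removable (DelSave G f u w) \<Longrightarrow> removable (G, f)"

definition weakly_degenerate :: "('a, 'b) pre_digraph \<Rightarrow> ('a \<Rightarrow> nat) \<Rightarrow> bool" where
  "weakly_degenerate G f \<longleftrightarrow> removable (G, \<lambda>v. int (f v))"

definition weak_degeneracy :: "('a, 'b) pre_digraph \<Rightarrow> nat" where
  "weak_degeneracy G = (LEAST d. weakly_degenerate G (\<lambda>_. d))"

text \<open>The minimum in \<^const>\<open>weak_degeneracy\<close> is attained for every finite graph.\<close>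

lemma removable_if_card_le:
  assumes "finite (verts G)" and "\<And>v. v \<in> verts G \<Longrightarrow> int (card (verts G)) \<le> f v"
  shows "removable (G, f)"
  using assms
proof (induction "card (verts G)" arbitrary: G f)
  case 0
  then show ?case by (auto intro: removable.empty)
next
  case (Suc k)
  then obtain u where u: "u \<in> verts G" by fastforce
  define G' where "G' = pre_digraph.del_vert G u"
  define f' where "f' = (\<lambda>v. if u \<rightarrow>\<^bsub>G\<^esub> v then f v - 1 else f v)"
  have Del: "Delete G f u = (G', f')"
    by (simp add: Delete_def G'_def f'_def)
  have verts: "verts G' = verts G - {u}"
    by (simp add: G'_def pre_digraph.verts_del_vert)
  have k: "k = card (verts G')" and fin: "finite (verts G')"
    using Suc.hyps(2) Suc.prems(1) u verts by auto
  have f': "int (card (verts G')) \<le> f' v" if "v \<in> verts G'" for v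
    using Suc.prems(2)[of v] that verts k Suc.hyps(2) by (auto simp: f'_def)
  have "removable (Delete G f u)"
    unfolding Del using Suc.hyps(1)[OF k fin f'] .
  moreover have "legal_Delete G f u"
    using u f' by (fastforce simp: legal_Delete_def nonneg_on_verts_def Del)
  ultimately show ?case by (rule removable.Delete[rotated])
qed

lemma weakly_degenerate_weak_degeneracy:
  assumes "finite (verts G)"
  shows "weakly_degenerate G (\<lambda>_. weak_degeneracy G)"
  unfolding weak_degeneracy_def
  by (rule LeastI[of _ "card (verts G)"])
     (auto simp: weakly_degenerate_def intro!: removable_if_card_le assms)

end

theory Submission
  imports Defs
begin

text \<open>
  Let \<open>G\<close> be triangle-free with \<open>n\<close> vertices and minimum degree at least \<open>d\<close>, and suppose that it
  is weakly \<open>k\<close>-degenerate with \<open>k \<le> d\<close>; put \<open>s = d - k\<close>. Consider the deficit \<open>deg v - f v\<close> of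
  a vertex, where the degree is taken in the graph that is still present. It starts out at \<open>s\<close> or
  more. When a neighbour of \<open>v\<close> is removed, both terms drop by one and the deficit is unchanged,
  unless the removal saves \<open>v\<close>, in which case the deficit drops by one. When \<open>v\<close> itself is removed,
  \<open>f v\<close> is non-negative, so the deficit is at most the number of neighbours still present. Thus
  \<open>v\<close> must have been saved at least \<open>s\<close> minus that number of times.

  Now sum this over the set \<open>R\<close> of the last \<open>m\<close> vertices to be removed. Each edge inside \<open>R\<close> is
  counted once, at the removal of its first endpoint, and every removal saves at most one vertex,
  so \<open>m s \<le> e(R) + n\<close> (lemma \<open>removable_late_vertices\<close>). By Mantel's theorem
  \<open>e(R) \<le> m\<^sup>2 / 4\<close> (lemma \<open>triangle_free_sum_degree_le\<close>). The choice \<open>m = 2 s\<close> turns the two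
  bounds into \<open>s\<^sup>2 \<le> n\<close>. Another use of Mantel's theorem gives \<open>2 d \<le> n\<close>, so that there are
  indeed \<open>2 s\<close> vertices to choose. Hence \<open>k \<ge> d - sqrt n\<close>, which is more than
  \<open>d - sqrt n - 1\<close>.
\<close>

section \<open>Degrees into a vertex set\<close>

definition degree_into :: "('a, 'b) pre_digraph \<Rightarrow> 'a set \<Rightarrow> 'a \<Rightarrow> nat" where
  "degree_into G A v = card {w \<in> A. v \<rightarrow>\<^bsub>G\<^esub> w}"

lemma degree_into_eq_sum:
  assumes "finite A"
  shows "degree_into G A v = (\<Sum>w\<in>A. of_bool (v \<rightarrow>\<^bsub>G\<^esub> w))"
  using assms by (simp add: degree_into_def Int_def sum.inter_filter[symmetric] of_bool_def)

lemma sum_degree_into_swap: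
  assumes "symmetric G" "finite A" "finite B"
  shows "(\<Sum>v\<in>A. degree_into G B v) = (\<Sum>w\<in>B. degree_into G A w)"
proof -
  have "(\<Sum>v\<in>A. degree_into G B v) = (\<Sum>w\<in>B. \<Sum>v\<in>A. of_bool (v \<rightarrow>\<^bsub>G\<^esub> w))"
    unfolding degree_into_eq_sum[OF assms(3)] by (rule sum.swap)
  also have "\<dots> = (\<Sum>w\<in>B. \<Sum>v\<in>A. of_bool (w \<rightarrow>\<^bsub>G\<^esub> v))"
    using arcs_ends_symmetric[OF assms(1)] by (intro sum.cong refl) (auto simp: of_bool_def)
  finally show ?thesis
    using assms by (simp add: degree_into_eq_sum)
qed

lemma degree_into_Diff:
  assumes "finite A" "N \<subseteq> A"
  shows "degree_into G A v = degree_into G (A - N) v + degree_into G N v"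
  unfolding degree_into_eq_sum[OF assms(1)] degree_into_eq_sum[OF finite_Diff[OF assms(1)]]
    degree_into_eq_sum[OF finite_subset[OF assms(2,1)]]
  by (rule sum.subset_diff[OF assms(2,1)])

lemma degree_into_verts_eq_out_degree:
  assumes "graph G"
  shows "degree_into G (verts G) v = out_degree G v"
proof -
  interpret graph G by fact
  have "bij_betw (head G) (out_arcs G v) {w \<in> verts G. v \<rightarrow>\<^bsub>G\<^esub> w}"
    unfolding bij_betw_def
    by (auto simp: inj_on_def arc_to_ends_def arcs_ends_conv intro: no_multi_arcs)
  then show ?thesis
    by (simp add: degree_into_def out_degree_def bij_betw_same_card)
qed

text \<open>
  Mantel's theorem for the graph induced on \<open>R\<close>, with edges counted twice. The neighbourhood \<open>N\<close> of
  a vertex of maximum degree \<open>\<Delta>\<close> in \<open>R\<close> is independent, so each edge has an endpoint among the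
  \<open>card R - \<Delta>\<close> vertices outside \<open>N\<close>, and each of these lies on at most \<open>\<Delta>\<close> edges.
\<close>

lemma triangle_free_sum_degree_le:
  assumes sym: "symmetric G" and free: "triangle_free G" and fin: "finite R"
  shows "2 * (\<Sum>v\<in>R. degree_into G R v) \<le> (card R)\<^sup>2"
proof (cases "R = {}")
  case False
  define \<Delta> where "\<Delta> = Max (degree_into G R ` R)"
  have le: "degree_into G R v \<le> \<Delta>" if "v \<in> R" for v
    using that fin by (simp add: \<Delta>_def)
  have "\<Delta> \<in> degree_into G R ` R"
    unfolding \<Delta>_def using False fin by (intro Max_in) auto
  then obtain x where x: "x \<in> R" "degree_into G R x = \<Delta>" by auto
  define N where "N = {w \<in> R. x \<rightarrow>\<^bsub>G\<^esub> w}"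
  have N: "N \<subseteq> R" "finite N" "card N = \<Delta>"
    using fin x by (auto simp: N_def degree_into_def)
  have "degree_into G N v = 0" if "v \<in> N" for v
  proof -
    have "\<not> v \<rightarrow>\<^bsub>G\<^esub> w" if "w \<in> N" for w
      using free \<open>v \<in> N\<close> that arcs_ends_symmetric[OF sym, of x w]
      unfolding triangle_free_def N_def by blast
    then have "{w \<in> N. v \<rightarrow>\<^bsub>G\<^esub> w} = {}" by blast
    then show ?thesis by (simp only: degree_into_def card.empty)
  qed
  then have indep: "degree_into G R v = degree_into G (R - N) v" if "v \<in> N" for v
    using degree_into_Diff[OF fin N(1), of G v] that by simp
  have outside: "(\<Sum>v\<in>R. degree_into G (R - N) v) \<le> (card R - \<Delta>) * \<Delta>"
  proof -
    have "(\<Sum>v\<in>R. degree_into G (R - N) v) = (\<Sum>v\<in>R - N. degree_into G R v)"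
      using sum_degree_into_swap[OF sym fin] fin by simp
    also have "\<dots> \<le> card (R - N) * \<Delta>"
      using sum_bounded_above[of "R - N" "degree_into G R" \<Delta>] le by simp
    finally show ?thesis using N by (simp add: card_Diff_subset)
  qed
  have "(\<Sum>v\<in>R. degree_into G N v) = (\<Sum>v\<in>N. degree_into G (R - N) v)"
    using sum_degree_into_swap[OF sym fin N(2)] indep by simp
  also have "\<dots> \<le> (\<Sum>v\<in>R. degree_into G (R - N) v)"
    using fin N(1) by (intro sum_mono2) auto
  finally have "(\<Sum>v\<in>R. degree_into G R v) \<le> 2 * ((card R - \<Delta>) * \<Delta>)"
    using outside by (simp add: degree_into_Diff[OF fin N(1)] sum.distrib)
  moreover have "4 * ((card R - \<Delta>) * \<Delta>) \<le> (card R)\<^sup>2"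
  proof -
    obtain e where e: "card R = \<Delta> + e"
      using card_mono[OF fin N(1)] N(3) le_Suc_ex by blast
    have "0 \<le> (int \<Delta> - int e)\<^sup>2" by simp
    then have "int (4 * (e * \<Delta>)) \<le> int ((\<Delta> + e)\<^sup>2)"
      by (simp add: power2_eq_square algebra_simps)
    then show ?thesis unfolding e by (simp only: of_nat_le_iff add_diff_cancel_left')
  qed
  ultimately show ?thesis by linarith
qed simp

section \<open>Counting saves over the last vertices to be removed\<close>

lemma dominates_del_vert:
  "v \<rightarrow>\<^bsub>pre_digraph.del_vert G u\<^esub> w \<longleftrightarrow> v \<rightarrow>\<^bsub>G\<^esub> w \<and> v \<noteq> u \<and> w \<noteq> u"
  by (auto simp: arcs_ends_conv pre_digraph.del_vert_simps)

lemma symmetric_del_vert: "symmetric G \<Longrightarrow> symmetric (pre_digraph.del_vert G u)"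
  unfolding symmetric_def sym_def dominates_del_vert by blast

text \<open>
  The inequality is \<open>\<Sum> deficits \<le> e(R) + n\<close>, multiplied by two so that the edge count \<open>e(R)\<close>
  becomes a sum of degrees. The summand \<open>n\<close> is the allowance of one save per removed vertex.
\<close>

definition deficit_bound :: "('a, 'b) pre_digraph \<Rightarrow> ('a \<Rightarrow> int) \<Rightarrow> nat \<Rightarrow> bool" where
  "deficit_bound G f m \<longleftrightarrow> (\<exists>R \<subseteq> verts G. card R = m \<and>
      2 * (\<Sum>v\<in>R. int (degree_into G (verts G) v) - f v)
        \<le> (\<Sum>v\<in>R. int (degree_into G R v)) + 2 * int (card (verts G)))"

text \<open>
  The bound is carried backwards over a single removal. It survives with \<open>R\<close> unchanged as
  long as \<open>u\<close> is not among the last \<open>m\<close> vertices; otherwise \<open>R\<close> is the entire vertex set and \<open>u\<close>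
  has to be added to it. The vertex \<open>w\<close> is the one that is saved; a plain deletion is covered by
  any choice of \<open>w\<close>.
\<close>

lemma late_vertices_step:
  fixes G :: "('a, 'b) pre_digraph" and f f' :: "'a \<Rightarrow> int" and u w :: 'a
  defines "G' \<equiv> pre_digraph.del_vert G u"
  assumes fin: "finite (verts G)" and sym: "symmetric G" and loopfree: "\<And>v. \<not> v \<rightarrow>\<^bsub>G\<^esub> v"
    and u: "u \<in> verts G" "f u \<ge> 0"
    and f': "\<And>v. f' v \<le> f v - of_bool (u \<rightarrow>\<^bsub>G\<^esub> v) + of_bool (v = w)"
    and m: "m \<le> card (verts G)"
    and IH: "\<And>m. m \<le> card (verts G') \<Longrightarrow> deficit_bound G' f' m"
  shows "deficit_bound G f m"
proof -
  have V': "verts G' = verts G - {u}"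
    by (simp add: G'_def pre_digraph.verts_del_vert)
  have card: "card (verts G) = Suc (card (verts G'))"
    unfolding V' by (rule card.remove[OF fin u(1)])
  have deg': "degree_into G' A v = degree_into G A v" if "v \<noteq> u" "u \<notin> A" for A v
  proof -
    have "{w \<in> A. v \<rightarrow>\<^bsub>G'\<^esub> w} = {w \<in> A. v \<rightarrow>\<^bsub>G\<^esub> w}"
      unfolding G'_def dominates_del_vert using that by auto
    then show ?thesis by (simp add: degree_into_def)
  qed
  have adj: "v \<rightarrow>\<^bsub>G\<^esub> u \<longleftrightarrow> u \<rightarrow>\<^bsub>G\<^esub> v" for v
    using arcs_ends_symmetric[OF sym] by blast
  have deg: "degree_into G (verts G) v = degree_into G (verts G') v + of_bool (u \<rightarrow>\<^bsub>G\<^esub> v)" for v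
  proof -
    have "(\<Sum>x\<in>verts G. of_bool (v \<rightarrow>\<^bsub>G\<^esub> x) :: nat)
        = of_bool (v \<rightarrow>\<^bsub>G\<^esub> u) + (\<Sum>x\<in>verts G'. of_bool (v \<rightarrow>\<^bsub>G\<^esub> x))"
      unfolding V' by (rule sum.remove[OF fin u(1)])
    then show ?thesis using fin V' by (simp add: degree_into_eq_sum adj)
  qed
  have deficit: "(\<Sum>v\<in>R. int (degree_into G (verts G) v) - f v)
      \<le> (\<Sum>v\<in>R. int (degree_into G' (verts G') v) - f' v) + 1" if R: "R \<subseteq> verts G'" for R
  proof -
    have "(\<Sum>v\<in>R. int (degree_into G (verts G) v) - f v)
        \<le> (\<Sum>v\<in>R. (int (degree_into G' (verts G') v) - f' v) + of_bool (v = w))"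
    proof (rule sum_mono)
      fix v assume "v \<in> R"
      then have "v \<noteq> u" using R V' by auto
      then have "degree_into G (verts G) v = degree_into G' (verts G') v + of_bool (u \<rightarrow>\<^bsub>G\<^esub> v)"
        using deg[of v] deg'[of v "verts G'"] V' by simp
      then show "int (degree_into G (verts G) v) - f v
          \<le> (int (degree_into G' (verts G') v) - f' v) + of_bool (v = w)"
        using f'[of v] by simp
    qed
    also have "\<dots> \<le> (\<Sum>v\<in>R. int (degree_into G' (verts G') v) - f' v) + 1"
    proof -
      have "finite R" using R V' fin by (metis finite_Diff finite_subset)
      then show ?thesis by (auto simp: sum.distrib of_bool_def sum.delta)
    qed
    finally show ?thesis .
  qed
  show ?thesis
  proof (cases "m = card (verts G)")
    case False
    then have "m \<le> card (verts G')" using m card by simp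
    from IH[OF this] obtain R where R: "R \<subseteq> verts G'" "card R = m"
      "2 * (\<Sum>v\<in>R. int (degree_into G' (verts G') v) - f' v)
        \<le> (\<Sum>v\<in>R. int (degree_into G' R v)) + 2 * int (card (verts G'))"
      unfolding deficit_bound_def by blast
    have "(\<Sum>v\<in>R. int (degree_into G' R v)) = (\<Sum>v\<in>R. int (degree_into G R v))"
      using R(1) V' by (intro sum.cong refl arg_cong[of _ _ int] deg') auto
    then have "2 * (\<Sum>v\<in>R. int (degree_into G (verts G) v) - f v)
        \<le> (\<Sum>v\<in>R. int (degree_into G R v)) + 2 * int (card (verts G))"
      using R(3) deficit[OF R(1)] card by simp
    then show ?thesis unfolding deficit_bound_def using R V' by blast
  next
    case True
    from IH[of "card (verts G')"] obtain R where R: "R \<subseteq> verts G'" "card R = card (verts G')"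
      "2 * (\<Sum>v\<in>R. int (degree_into G' (verts G') v) - f' v)
        \<le> (\<Sum>v\<in>R. int (degree_into G' R v)) + 2 * int (card (verts G'))"
      unfolding deficit_bound_def by blast
    have [simp]: "R = verts G'"
      using R(1,2) fin V' card_subset_eq by (metis finite_Diff)
    have edges: "(\<Sum>v\<in>verts G. int (degree_into G (verts G) v))
        = (\<Sum>v\<in>R. int (degree_into G' R v)) + 2 * int (degree_into G (verts G) u)"
    proof -
      have "(\<Sum>v\<in>verts G. degree_into G (verts G) v)
          = degree_into G (verts G) u + (\<Sum>v\<in>verts G'. degree_into G (verts G) v)"
        unfolding V' by (rule sum.remove[OF fin u(1)])
      also have "(\<Sum>v\<in>verts G'. degree_into G (verts G) v)
          = (\<Sum>v\<in>verts G'. degree_into G' (verts G') v) + degree_into G (verts G') u"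
      proof -
        have "(\<Sum>v\<in>verts G'. degree_into G (verts G') v) = (\<Sum>v\<in>verts G'. degree_into G' (verts G') v)"
          using V' by (intro sum.cong refl) (simp add: deg')
        moreover have "degree_into G (verts G') u = (\<Sum>v\<in>verts G'. of_bool (u \<rightarrow>\<^bsub>G\<^esub> v))"
          using fin V' by (simp add: degree_into_eq_sum)
        moreover have "(\<Sum>v\<in>verts G'. degree_into G (verts G) v)
            = (\<Sum>v\<in>verts G'. degree_into G (verts G') v) + (\<Sum>v\<in>verts G'. of_bool (u \<rightarrow>\<^bsub>G\<^esub> v))"
          unfolding sum.distrib[symmetric] by (intro sum.cong refl deg)
        ultimately show ?thesis by simp
      qed
      also have "degree_into G (verts G') u = degree_into G (verts G) u"
        using deg[of u] loopfree by simp
      finally have "(\<Sum>v\<in>verts G. degree_into G (verts G) v)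
          = (\<Sum>v\<in>R. degree_into G' R v) + 2 * degree_into G (verts G) u" by simp
      then show ?thesis
        unfolding of_nat_sum[symmetric] by (simp only: of_nat_add of_nat_mult of_nat_numeral)
    qed
    have "(\<Sum>v\<in>verts G. int (degree_into G (verts G) v) - f v)
        = (int (degree_into G (verts G) u) - f u)
          + (\<Sum>v\<in>verts G'. int (degree_into G (verts G) v) - f v)"
      unfolding V' by (rule sum.remove[OF fin u(1)])
    then have "2 * (\<Sum>v\<in>verts G. int (degree_into G (verts G) v) - f v)
        \<le> (\<Sum>v\<in>verts G. int (degree_into G (verts G) v)) + 2 * int (card (verts G))"
      using R(3) deficit[OF R(1)] card u(2) edges by simp
    then show ?thesis unfolding deficit_bound_def using True by blast
  qed
qed

text \<open>
  The witness consists of the last \<open>m\<close> vertices to be removed. Each of them may keep, at its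
  removal, a deficit as large as its number of surviving neighbours, and these numbers add up to
  the number of edges among the \<open>m\<close> vertices. The rest of the initial deficit must have been paid
  for by saves, at most one per removed vertex.
\<close>

lemma removable_late_vertices:
  assumes "removable (G, f)" "finite (verts G)" "symmetric G" "\<And>v. \<not> v \<rightarrow>\<^bsub>G\<^esub> v"
    "\<And>v. v \<in> verts G \<Longrightarrow> f v \<ge> 0" "m \<le> card (verts G)"
  shows "deficit_bound G f m"
  using assms
proof (induction "(G, f)" arbitrary: G f m rule: removable.induct)
  case (empty G f)
  then show ?case by (auto simp: deficit_bound_def)
next
  case (Delete G f u)
  define f' where "f' = (\<lambda>v. if u \<rightarrow>\<^bsub>G\<^esub> v then f v - 1 else f v)"
  have D: "Delete G f u = (pre_digraph.del_vert G u, f')"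
    by (simp add: Delete_def f'_def)
  have u: "u \<in> verts G"
    and nonneg: "\<And>v. v \<in> verts (pre_digraph.del_vert G u) \<Longrightarrow> f' v \<ge> 0"
    using Delete.hyps(1) by (auto simp: legal_Delete_def nonneg_on_verts_def D)
  have IH: "deficit_bound (pre_digraph.del_vert G u) f' m"
    if "m \<le> card (verts (pre_digraph.del_vert G u))" for m
    using Delete.hyps(3)[OF D _ _ _ _ that] Delete.prems(1,3) symmetric_del_vert[OF Delete.prems(2)] nonneg
    by (simp add: dominates_del_vert pre_digraph.verts_del_vert)
  have "f' v \<le> f v - of_bool (u \<rightarrow>\<^bsub>G\<^esub> v) + of_bool (v = u)" for v
    by (simp add: f'_def)
  from late_vertices_step[OF Delete.prems(1-3) u Delete.prems(4)[OF u] this Delete.prems(5) IH]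
  show ?case .
next
  case (DelSave G f u w)
  define f' where "f' = (\<lambda>v. if u \<rightarrow>\<^bsub>G\<^esub> v \<and> v \<noteq> w then f v - 1 else f v)"
  have D: "DelSave G f u w = (pre_digraph.del_vert G u, f')"
    by (simp add: DelSave_def f'_def)
  have u: "u \<in> verts G"
    and nonneg: "\<And>v. v \<in> verts (pre_digraph.del_vert G u) \<Longrightarrow> f' v \<ge> 0"
    using DelSave.hyps(1) by (auto simp: legal_DelSave_def nonneg_on_verts_def D)
  have IH: "deficit_bound (pre_digraph.del_vert G u) f' m"
    if "m \<le> card (verts (pre_digraph.del_vert G u))" for m
    using DelSave.hyps(3)[OF D _ _ _ _ that] DelSave.prems(1,3) symmetric_del_vert[OF DelSave.prems(2)] nonneg
    by (simp add: dominates_del_vert pre_digraph.verts_del_vert)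
  have "f' v \<le> f v - of_bool (u \<rightarrow>\<^bsub>G\<^esub> v) + of_bool (v = w)" for v
    by (simp add: f'_def)
  from late_vertices_step[OF DelSave.prems(1-3) u DelSave.prems(4)[OF u] this DelSave.prems(5) IH]
  show ?case .
qed

section \<open>Weak degeneracy of triangle-free graphs\<close>

lemma triangle_free_min_degree_le:
  assumes sym: "symmetric G" and free: "triangle_free G"
    and fin: "finite (verts G)" and nonempty: "verts G \<noteq> {}"
    and min_degree: "\<And>v. v \<in> verts G \<Longrightarrow> d \<le> degree_into G (verts G) v"
  shows "2 * d \<le> card (verts G)"
proof -
  have "card (verts G) * d \<le> (\<Sum>v\<in>verts G. degree_into G (verts G) v)"
    using sum_bounded_below[of "verts G" d "degree_into G (verts G)"] min_degree by simp
  then have "2 * (card (verts G) * d) \<le> card (verts G) * card (verts G)"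
    using triangle_free_sum_degree_le[OF sym free fin] unfolding power2_eq_square by linarith
  then have "card (verts G) * (2 * d) \<le> card (verts G) * card (verts G)"
    by (simp only: mult.left_commute)
  then show ?thesis
    using fin nonempty by (simp only: mult_le_cancel1) (simp add: card_gt_0_iff)
qed

lemma weakly_degenerate_triangle_free:
  assumes G: "graph G" and free: "triangle_free G" and nonempty: "verts G \<noteq> {}"
    and min_degree: "\<And>v. v \<in> verts G \<Longrightarrow> d \<le> out_degree G v"
    and wd: "weakly_degenerate G (\<lambda>_. k)"
  shows "(d - k)\<^sup>2 \<le> card (verts G)"
proof (cases "k \<le> d")
  case True
  interpret graph G by fact
  have sym: "symmetric G" by (rule sym_arcs)
  have deg: "d \<le> degree_into G (verts G) v" if "v \<in> verts G" for v
    using min_degree[OF that] by (simp add: degree_into_verts_eq_out_degree[OF G])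
  define s where "s = d - k"
  have "2 * s \<le> card (verts G)"
    using triangle_free_min_degree_le[OF sym free finite_verts nonempty deg] by (simp add: s_def)
  from removable_late_vertices[OF wd[unfolded weakly_degenerate_def] finite_verts sym _ _ this]
    adj_not_same
  obtain R where R: "R \<subseteq> verts G" "card R = 2 * s"
    and late: "2 * (\<Sum>v\<in>R. int (degree_into G (verts G) v) - int k)
      \<le> (\<Sum>v\<in>R. int (degree_into G R v)) + 2 * int (card (verts G))"
    unfolding deficit_bound_def by auto
  have "int (card R) * int s \<le> (\<Sum>v\<in>R. int (degree_into G (verts G) v) - int k)"
  proof -
    have "int s \<le> int (degree_into G (verts G) v) - int k" if "v \<in> R" for v
      using deg[of v] that R(1) True by (auto simp: s_def)
    then show ?thesis
      using sum_bounded_below[of R "int s"] by simp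
  qed
  moreover have "2 * (\<Sum>v\<in>R. int (degree_into G R v)) \<le> int ((card R)\<^sup>2)"
  proof -
    have "2 * (\<Sum>v\<in>R. degree_into G R v) \<le> (card R)\<^sup>2"
      using R(1) by (intro triangle_free_sum_degree_le sym free) (simp add: finite_subset)
    then show ?thesis
      unfolding of_nat_sum[symmetric] by linarith
  qed
  ultimately have "4 * (int (2 * s) * int s) \<le> int ((2 * s)\<^sup>2) + 4 * int (card (verts G))"
    using late unfolding R(2) by linarith
  then have "int (s\<^sup>2) \<le> int (card (verts G))"
    by (simp add: power2_eq_square)
  then show ?thesis by (simp only: s_def of_nat_le_iff)
qed simp

lemma weak_degeneracy_triangle_free:
  assumes "graph G" "triangle_free G" "verts G \<noteq> {}"
    and "\<And>v. v \<in> verts G \<Longrightarrow> d \<le> out_degree G v"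
  shows "real d - sqrt (real (card (verts G))) \<le> real (weak_degeneracy G)"
proof -
  interpret graph G by fact
  have "(d - weak_degeneracy G)\<^sup>2 \<le> card (verts G)"
    by (rule weakly_degenerate_triangle_free[OF assms
          weakly_degenerate_weak_degeneracy[OF finite_verts]])
  then have "(real (d - weak_degeneracy G))\<^sup>2 \<le> real (card (verts G))"
    by (metis of_nat_le_iff of_nat_power)
  then have "real (d - weak_degeneracy G) \<le> sqrt (real (card (verts G)))"
    by (rule real_le_rsqrt)
  then show ?thesis by linarith
qed

lemma complete_bipartite_regular_triangle_free:
  assumes K: "K\<^bsub>d,d\<^esub> H" and d: "d > 0"
  shows "regular_graph d H" "triangle_free H" "card (verts H) = 2 * d"
proof -
  from K obtain U V where H: "graph H" "verts H = U \<union> V" "U \<inter> V = {}" "card U = d" "card V = d"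
    "arcs_ends H = U \<times> V \<union> V \<times> U"
    by (auto simp: complete_bipartite_digraph_def)
  have "finite U" "finite V"
    using H(4,5) d by (auto intro: card_ge_0_finite)
  then show "card (verts H) = 2 * d"
    using H by (simp add: card_Un_disjoint)
  show "triangle_free H"
    using H(3) unfolding triangle_free_def H(6) by auto
  have "{w \<in> verts H. v \<rightarrow>\<^bsub>H\<^esub> w} = (if v \<in> U then V else U)" if "v \<in> verts H" for v
    using that H(3) unfolding H(2,6) by auto
  then show "regular_graph d H"
    using H(4,5)
    by (simp add: regular_graph_def degree_into_def flip: degree_into_verts_eq_out_degree[OF H(1)])
qed

theorem proposition1p9:
  shows "(\<forall>(G :: ('a, 'b) pre_digraph) (d :: nat) (n :: nat).
            graph G \<and> triangle_free G \<and> regular_graph d G \<and> card (verts G) = n \<and> n \<ge> 4 \<longrightarrow>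
              real (weak_degeneracy G) > real d - sqrt (real n) - 1) \<and>
         (\<forall>(H :: ('a, 'b) pre_digraph) (d :: nat).
            d \<ge> 2 \<and> K\<^bsub>d,d\<^esub> H \<longrightarrow>
              real (weak_degeneracy H) > real d - sqrt (2 * real d) - 1)"
proof -
  have regular: "real (weak_degeneracy G) > real d - sqrt (real (card (verts G))) - 1"
    if "graph G" "triangle_free G" "regular_graph d G" "card (verts G) \<ge> 4"
    for G :: "('a, 'b) pre_digraph" and d
  proof -
    have "verts G \<noteq> {}" using that(4) by auto
    moreover have "d \<le> out_degree G v" if "v \<in> verts G" for v
      using that \<open>regular_graph d G\<close> by (simp add: regular_graph_def)
    ultimately show ?thesis
      using weak_degeneracy_triangle_free[of G d] that by fastforce
  qed
  have "real (weak_degeneracy H) > real d - sqrt (2 * real d) - 1"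
    if "d \<ge> 2" "K\<^bsub>d,d\<^esub> H" for H :: "('a, 'b) pre_digraph" and d
    using regular[of H d] complete_bipartite_regular_triangle_free[of d H] that
    by (simp add: complete_bipartite_digraph_def)
  with regular show ?thesis by blast
qed

end
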